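(* The point $(x_0,x)=x_0e_0+x\in\mathbb R^4\setminus\{0\}$ (with $x\in\mathbb R^3$) has the following null 3-vector form in $\Lambda^3(\mathbb R^{3,3})$: $$(e_0x)\wedge((e_0x)\cdot J_3)-x_0(e_0x)\wedge K_2+x_0^2I_3,$$ and the plane $(n,-d)$, with $n\in\mathbb R^3$, $d\in\mathbb R$ not both zero, has the null 3-vector form $$n^\perp\wedge(n^\perp\cdot I_3)-d\,n^\perp\wedge K_2+d^2J_3.$$
   Context: Let $e_0,e_1,e_2,e_3$ be the standard orthonormal basis of $\mathbb R^4$ and identify $\mathbb R^3=\mathrm{span}(e_1,e_2,e_3)$. Juxtaposition $ab$ of vectors of $\mathbb R^4$ is the outer product in $\Lambda^2(\mathbb R^4)=\mathbb R^{3,3}$, while $\wedge$ is the outer product of $\Lambda(\mathbb R^{3,3})$. $\mathbb R^{3,3}$ has basis $E_i=e_0e_i$ ($i=1,2,3$), $E_1'=e_2e_3$, $E_2'=e_3e_1$, $E_3'=e_1e_2$ and symmetric bilinear form $E_i\cdot E_j'=\delta_{ij}$, $E_i\cdot E_j=E_i'\cdot E_j'=0$. For $n\in\mathbb R^3$, $n^\perp=n_1E_1'+n_2E_2'+n_3E_3'$. Put $I_3=E_1\wedge E_2\wedge E_3$, $J_3=E_1'\wedge E_2'\wedge E_3'$, $K_2=\sum_iE_i\wedge E_i'$; for a vector $a$, $a\cdot(b_1\wedge b_2\wedge b_3)=(a\cdot b_1)b_2\wedge b_3-(a\cdot b_2)b_1\wedge b_3+(a\cdot b_3)b_1\wedge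 b_2$. The plane $(n,-d)$ is the set of projective points $(x_0,x)$ with $-dx_0+n\cdot x=0$. A point $X$ corresponds to the null 3-space of $\mathbb R^{3,3}$ spanned by all lines through it, $\{XY:Y\in\mathbb R^4\}$; a plane corresponds to the null 3-space spanned by all lines $XY$ with $X,Y$ on the plane. A (null) 3-vector form of a point or plane is a nonzero decomposable element $a\wedge b\wedge c\in\Lambda^3(\mathbb R^{3,3})$ such that $a,b,c$ span the corresponding null 3-space. *)

theory Defs
  imports "HOL-Analysis.Analysis"
begin

text \<open>
  \<open>\<real>\<^sup>4\<close> is \<open>\<real> \<times> \<real>\<^sup>3\<close>, so that \<open>x\<^sub>0 e\<^sub>0 + x\<close> is literally the pair \<open>(x\<^sub>0, x)\<close>, with
  \<open>e\<^sub>0 = (1, 0)\<close> and \<open>x \<in> \<real>\<^sup>3\<close> identified with \<open>(0, x)\<close>. The six-dimensional space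
  \<open>\<real>\<^sup>3\<^sup>,\<^sup>3 = \<Lambda>\<^sup>2(\<real>\<^sup>4)\<close> has one coordinate for each of the basis elements \<open>E\<^sub>i\<close> (index \<open>Inl i\<close>)
  and \<open>E\<^sub>i'\<close> (index \<open>Inr i\<close>); in the index type \<open>3\<close> the numeral \<open>3\<close> is the element \<open>0\<close>.

  The exterior powers \<open>\<Lambda>\<^sup>2\<close> and \<open>\<Lambda>\<^sup>3\<close> of \<open>\<real>\<^sup>n\<close> are realised as antisymmetric tensors, normalised
  by \<open>a \<and> b = a \<otimes> b - b \<otimes> a\<close>, and \<open>a \<and> b \<and> c\<close> is the signed sum over all six
  permutations of \<open>a \<otimes> b \<otimes> c\<close>.
\<close>

type_synonym vec4 = "real \<times> (real^3)"
type_synonym vec33 = "real^(3 + 3)"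
type_synonym 'n bivector = "real^'n^'n"
type_synonym 'n trivector = "real^'n^'n^'n"

definition e0 :: vec4 where
  "e0 = (1, 0)"

definition emb :: "real^3 \<Rightarrow> vec4" where
  "emb x = (0, x)"

definition E :: "3 \<Rightarrow> vec33" where
  "E i = axis (Inl i) 1"

definition E' :: "3 \<Rightarrow> vec33" where
  "E' i = axis (Inr i) 1"

text \<open>
  The outer product of \<open>\<real>\<^sup>4\<close>. From \<open>E\<^sub>i = e\<^sub>0e\<^sub>i\<close> and \<open>E\<^sub>1' = e\<^sub>2e\<^sub>3\<close>, \<open>E\<^sub>2' = e\<^sub>3e\<^sub>1\<close>, \<open>E\<^sub>3' = e\<^sub>1e\<^sub>2\<close>,
  the coordinates of \<open>XY\<close> are the Pluecker coordinates; the lemmas below say that this is the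
  alternating bilinear map with the prescribed values on the basis.
\<close>

definition outer :: "vec4 \<Rightarrow> vec4 \<Rightarrow> vec33" where
  "outer X Y = (\<Sum>i\<in>UNIV. (fst X * snd Y $ i - fst Y * snd X $ i) *\<^sub>R E i
                       + cross3 (snd X) (snd Y) $ i *\<^sub>R E' i)"

definition form33 :: "vec33 \<Rightarrow> vec33 \<Rightarrow> real"  (infix "\<bullet>\<^sub>3\<^sub>3" 70) where
  "a \<bullet>\<^sub>3\<^sub>3 b = (\<Sum>i\<in>UNIV. a $ Inl i * b $ Inr i + a $ Inr i * b $ Inl i)"

definition wedge2 :: "real^'n \<Rightarrow> real^'n \<Rightarrow> 'n bivector"  (infixr "\<and>\<^sub>2" 75) where
  "a \<and>\<^sub>2 b = (\<chi> i j. a $ i * b $ j - a $ j * b $ i)"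

definition wedge3 :: "real^'n \<Rightarrow> 'n bivector \<Rightarrow> 'n trivector"  (infixr "\<and>\<^sub>3" 75) where
  "a \<and>\<^sub>3 B = (\<chi> i j k. a $ i * B $ j $ k - a $ j * B $ i $ k + a $ k * B $ i $ j)"

text \<open>
  The inner product of a vector with a 3-vector, as contraction of the first tensor slot; on
  decomposable 3-vectors it is given by lemma \<open>contract_wedge\<close>.
\<close>

definition contract :: "vec33 \<Rightarrow> (3 + 3) trivector \<Rightarrow> (3 + 3) bivector" where
  "contract a T = (\<Sum>i\<in>UNIV. (a \<bullet>\<^sub>3\<^sub>3 axis i 1) *\<^sub>R T $ i)"

definition perp :: "real^3 \<Rightarrow> vec33" where
  "perp n = (\<Sum>i\<in>UNIV. n $ i *\<^sub>R E' i)"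

definition I3 :: "(3 + 3) trivector" where
  "I3 = E 1 \<and>\<^sub>3 E 2 \<and>\<^sub>2 E 3"

definition J3 :: "(3 + 3) trivector" where
  "J3 = E' 1 \<and>\<^sub>3 E' 2 \<and>\<^sub>2 E' 3"

definition K2 :: "(3 + 3) bivector" where
  "K2 = (\<Sum>i\<in>UNIV. E i \<and>\<^sub>2 E' i)"

definition point_space :: "vec4 \<Rightarrow> vec33 set" where
  "point_space X = span {outer X Y |Y. True}"

definition plane :: "(real^3) \<times> real \<Rightarrow> vec4 set" where
  "plane p = {X. X \<noteq> 0 \<and> snd p * fst X + fst p \<bullet> snd X = 0}"

definition plane_space :: "(real^3) \<times> real \<Rightarrow> vec33 set" where
  "plane_space p = span {outer X Y |X Y. X \<in> plane p \<and> Y \<in> plane p}"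

definition null_3_space :: "vec33 set \<Rightarrow> bool" where
  "null_3_space S \<longleftrightarrow> subspace S \<and> dim S = 3 \<and> (\<forall>u\<in>S. \<forall>v\<in>S. u \<bullet>\<^sub>3\<^sub>3 v = 0)"

definition null_3_vector_form :: "(3 + 3) trivector \<Rightarrow> vec33 set \<Rightarrow> bool" where
  "null_3_vector_form T S \<longleftrightarrow>
     null_3_space S \<and> T \<noteq> 0 \<and> (\<exists>a b c. T = a \<and>\<^sub>3 b \<and>\<^sub>2 c \<and> span {a, b, c} = S)"


lemma outer_nth [simp]:
  "outer X Y $ Inl i = fst X * snd Y $ i - fst Y * snd X $ i"
  "outer X Y $ Inr i = cross3 (snd X) (snd Y) $ i"
  by (simp_all add: outer_def E_def E'_def axis_def sum.distrib if_distrib cong: if_cong)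

lemma vec33_eq_iff: "a = b \<longleftrightarrow> (\<forall>i. a $ Inl i = b $ Inl i) \<and> (\<forall>i. a $ Inr i = b $ Inr i)"
  for a b :: vec33
  by (metis vec_eq_iff sum.exhaust)

lemma bilinear_outer: "bilinear outer"
  by (auto simp: bilinear_def vec33_eq_iff cross3_simps forall_3 algebra_simps intro!: linearI)

lemma outer_self: "outer X X = 0"
  by (simp add: vec33_eq_iff)

lemma outer_e0: "outer e0 (emb (axis i 1)) = E i"
  by (auto simp: vec33_eq_iff e0_def emb_def E_def axis_def)

lemma outer_basis:
  "outer (emb (axis 2 1)) (emb (axis 3 1)) = E' 1"
  "outer (emb (axis 3 1)) (emb (axis 1 1)) = E' 2"
  "outer (emb (axis 1 1)) (emb (axis 2 1)) = E' 3"
  by (auto simp: vec33_eq_iff emb_def E'_def axis_def cross3_def forall_3)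

lemma form33_basis:
  "E i \<bullet>\<^sub>3\<^sub>3 E' j = (if i = j then 1 else 0)" "E' i \<bullet>\<^sub>3\<^sub>3 E j = (if i = j then 1 else 0)"
  "E i \<bullet>\<^sub>3\<^sub>3 E j = 0" "E' i \<bullet>\<^sub>3\<^sub>3 E' j = 0"
  using exhaust_3[of i] exhaust_3[of j]
  by (auto simp: form33_def E_def E'_def axis_def sum_3)

lemma bilinear_form33: "bilinear form33"
  by (auto simp: bilinear_def form33_def algebra_simps sum.distrib sum_distrib_left
      intro!: linearI)

lemma form33_expand: "a \<bullet>\<^sub>3\<^sub>3 b = (\<Sum>i\<in>UNIV. (a \<bullet>\<^sub>3\<^sub>3 axis i 1) * b $ i)"
proof -
  have "b = (\<Sum>i\<in>UNIV. b $ i *\<^sub>R axis i 1)"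
    using basis_expansion[of b] by (simp add: scalar_mult_eq_scaleR)
  then have "a \<bullet>\<^sub>3\<^sub>3 b = a \<bullet>\<^sub>3\<^sub>3 (\<Sum>i\<in>UNIV. b $ i *\<^sub>R axis i 1)"
    by simp
  also have "\<dots> = (\<Sum>i\<in>UNIV. (a \<bullet>\<^sub>3\<^sub>3 axis i 1) * b $ i)"
    using bilinear_form33 by (simp add: bilinear_def linear_sum linear_scale mult.commute)
  finally show ?thesis .
qed

lemma bilinear_wedge2: "bilinear (\<and>\<^sub>2)"
  by (auto simp: bilinear_def wedge2_def vec_eq_iff algebra_simps intro!: linearI)

lemma bilinear_wedge3: "bilinear (\<and>\<^sub>3)"
  by (auto simp: bilinear_def wedge3_def vec_eq_iff algebra_simps intro!: linearI)

lemma wedge_alternating: "a \<and>\<^sub>2 a = 0" "a \<and>\<^sub>3 a \<and>\<^sub>2 b = 0" "a \<and>\<^sub>3 b \<and>\<^sub>2 c = b \<and>\<^sub>3 c \<and>\<^sub>2 a"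
  by (simp_all add: wedge2_def wedge3_def vec_eq_iff algebra_simps)

lemma contract_wedge:
  "contract a (b1 \<and>\<^sub>3 b2 \<and>\<^sub>2 b3) =
     (a \<bullet>\<^sub>3\<^sub>3 b1) *\<^sub>R (b2 \<and>\<^sub>2 b3) - (a \<bullet>\<^sub>3\<^sub>3 b2) *\<^sub>R (b1 \<and>\<^sub>2 b3) + (a \<bullet>\<^sub>3\<^sub>3 b3) *\<^sub>R (b1 \<and>\<^sub>2 b2)"
  unfolding vec_eq_iff
  by (simp add: contract_def wedge2_def wedge3_def form33_expand[of a b1]
      form33_expand[of a b2] form33_expand[of a b3] sum_distrib_right sum_distrib_left
      flip: sum.distrib sum_subtractf) (simp add: algebra_simps)

end

theory Submission imports Defs begin

text \<open>
  Let \<open>X = (x\<^sub>0, x)\<close>. If \<open>X, p, q, r\<close> is a basis of \<open>\<real>\<^sup>4\<close>, then \<open>Xp, Xq, Xr\<close> span the space of \<open>X\<close>, and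
  \<open>Xp \<and> Xq \<and> Xr\<close> is a multiple of the claimed 3-vector: the factor is \<open>x\<^sub>0\<close> for
  \<open>p, q, r = e\<^sub>1, e\<^sub>2, e\<^sub>3\<close>, and \<open>-x\<^sub>k\<close> if \<open>p = e\<^sub>0\<close> and \<open>q, r\<close> are the other two basis vectors of
  \<open>\<real>\<^sup>3\<close> in cyclic order. One of these factors is nonzero.

  Exchanging \<open>E\<^sub>i\<close> and \<open>E\<^sub>i'\<close> is an isometry of \<open>\<real>\<^sup>3\<^sup>,\<^sup>3\<close> (the Hodge star of \<open>\<Lambda>\<^sup>2(\<real>\<^sup>4)\<close>). It maps the
  space of the point \<open>(-d, n)\<close> to that of the plane \<open>(n, -d)\<close>, and likewise their
  3-vector forms; the middle term changes sign twice, since the exchange negates \<open>K\<^sub>2\<close>.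
\<close>

section \<open>The two 3-vectors in coordinates\<close>

definition point_trivector :: "real \<Rightarrow> real^3 \<Rightarrow> (3 + 3) trivector" where
  "point_trivector x0 x = outer e0 (emb x) \<and>\<^sub>3 contract (outer e0 (emb x)) J3
     - x0 *\<^sub>R (outer e0 (emb x) \<and>\<^sub>3 K2) + x0\<^sup>2 *\<^sub>R I3"

definition plane_trivector :: "real^3 \<Rightarrow> real \<Rightarrow> (3 + 3) trivector" where
  "plane_trivector n d = perp n \<and>\<^sub>3 contract (perp n) I3 - d *\<^sub>R (perp n \<and>\<^sub>3 K2) + d\<^sup>2 *\<^sub>R J3"

lemma forall_sum: "(\<forall>i::'a + 'b. P i) \<longleftrightarrow> (\<forall>i. P (Inl i)) \<and> (\<forall>i. P (Inr i))"
  by (metis sum.exhaust)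

lemma E_nth [simp]:
  "E i $ Inl j = (if i = j then 1 else 0)" "E i $ Inr j = 0"
  "E' i $ Inl j = 0" "E' i $ Inr j = (if i = j then 1 else 0)"
  by (auto simp: E_def E'_def axis_def)

lemma perp_nth [simp]: "perp n $ Inl i = 0" "perp n $ Inr i = n $ i"
  by (simp_all add: perp_def if_distrib cong: if_cong)

lemma outer_e0_emb: "outer e0 (emb x) = (\<Sum>i\<in>UNIV. x $ i *\<^sub>R E i)"
  by (auto simp: vec33_eq_iff e0_def emb_def if_distrib cross3_simps forall_3 cong: if_cong)

text \<open>Once \<open>contract_wedge\<close> has evaluated the contraction, only wedges of basis
  vectors remain, so identities between 3-vectors become polynomial identities, one for each
  component.\<close>

lemma point_trivector_expand:
  "point_trivector x0 x = (\<Sum>i\<in>UNIV. x $ i *\<^sub>R E i) \<and>\<^sub>3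
       (x $ 1 *\<^sub>R (E' 2 \<and>\<^sub>2 E' 3) - x $ 2 *\<^sub>R (E' 1 \<and>\<^sub>2 E' 3) + x $ 3 *\<^sub>R (E' 1 \<and>\<^sub>2 E' 2))
     - x0 *\<^sub>R ((\<Sum>i\<in>UNIV. x $ i *\<^sub>R E i) \<and>\<^sub>3 (\<Sum>i\<in>UNIV. E i \<and>\<^sub>2 E' i))
     + x0\<^sup>2 *\<^sub>R (E 1 \<and>\<^sub>3 E 2 \<and>\<^sub>2 E 3)"
  unfolding point_trivector_def outer_e0_emb J3_def I3_def K2_def contract_wedge
  by (simp add: form33_def sum_3)

lemma plane_trivector_expand:
  "plane_trivector n d = perp n \<and>\<^sub>3
       (n $ 1 *\<^sub>R (E 2 \<and>\<^sub>2 E 3) - n $ 2 *\<^sub>R (E 1 \<and>\<^sub>2 E 3) + n $ 3 *\<^sub>R (E 1 \<and>\<^sub>2 E 2))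
     - d *\<^sub>R (perp n \<and>\<^sub>3 (\<Sum>i\<in>UNIV. E i \<and>\<^sub>2 E' i)) + d\<^sup>2 *\<^sub>R (E' 1 \<and>\<^sub>3 E' 2 \<and>\<^sub>2 E' 3)"
  unfolding plane_trivector_def J3_def I3_def K2_def contract_wedge
  by (simp add: form33_def sum_3)

lemma wedge_outer_emb:
  "outer (x0, x) (emb (axis 1 1)) \<and>\<^sub>3 outer (x0, x) (emb (axis 2 1)) \<and>\<^sub>2 outer (x0, x) (emb (axis 3 1))
     = x0 *\<^sub>R point_trivector x0 x"
  unfolding point_trivector_expand
  by (simp add: vec_eq_iff forall_sum forall_3 wedge2_def wedge3_def sum_3 emb_def cross3_def axis_def
     power2_eq_square algebra_simps)

lemma wedge_outer_e0:
  "outer (x0, x) e0 \<and>\<^sub>3 outer (x0, x) (emb (axis 2 1)) \<and>\<^sub>2 outer (x0, x) (emb (axis 3 1))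
     = (- (x $ 1)) *\<^sub>R point_trivector x0 x"
  "outer (x0, x) e0 \<and>\<^sub>3 outer (x0, x) (emb (axis 3 1)) \<and>\<^sub>2 outer (x0, x) (emb (axis 1 1))
     = (- (x $ 2)) *\<^sub>R point_trivector x0 x"
  "outer (x0, x) e0 \<and>\<^sub>3 outer (x0, x) (emb (axis 1 1)) \<and>\<^sub>2 outer (x0, x) (emb (axis 2 1))
     = (- (x $ 3)) *\<^sub>R point_trivector x0 x"
  unfolding point_trivector_expand
  by (simp_all add: vec_eq_iff forall_sum forall_3 wedge2_def wedge3_def sum_3 emb_def e0_def cross3_def
     axis_def power2_eq_square algebra_simps)

section \<open>Decomposable 3-vectors and the spaces they span\<close>

lemma wedge3_scaleR: "(c *\<^sub>R a) \<and>\<^sub>3 B = c *\<^sub>R (a \<and>\<^sub>3 B)" "a \<and>\<^sub>3 (c *\<^sub>R B) = c *\<^sub>R (a \<and>\<^sub>3 B)"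
  by (rule bilinear_lmul[OF bilinear_wedge3], rule bilinear_rmul[OF bilinear_wedge3])

text \<open>A triple product vanishes as soon as its first factor lies in the span of the other two.
  Cyclic symmetry carries this to every position, so a nonzero product has independent
  factors.\<close>

lemma dim_span_wedge3:
  fixes a b c :: "real^'n"
  assumes "a \<and>\<^sub>3 b \<and>\<^sub>2 c \<noteq> 0"
  shows "dim (span {a, b, c}) = 3"
proof -
  have dep: "u \<and>\<^sub>3 v \<and>\<^sub>2 w = 0" if u: "u \<in> span {v, w}" for u v w :: "real^'n"
  proof -
    obtain k l where "u - k *\<^sub>R v = l *\<^sub>R w"
      using u unfolding span_breakdown_eq[of _ v] span_singleton by blast
    then have "u = k *\<^sub>R v + l *\<^sub>R w"
      by (simp add: algebra_simps)
    then show ?thesis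
      by (simp add: wedge2_def wedge3_def vec_eq_iff algebra_simps)
  qed
  have a: "a \<notin> span {b, c}" and b: "b \<notin> span {c, a}" and c: "c \<notin> span {a, b}"
    using dep[of a b c] dep[of b c a] dep[of c a b] assms
      wedge_alternating(3)[of a b c] wedge_alternating(3)[of b c a] by auto
  have "b \<notin> span {c}"
    using b span_mono[of "{c}" "{c, a}"] by blast
  moreover have "a \<noteq> b" "a \<noteq> c" "b \<noteq> c"
    using a b span_base[of a "{b, c}"] span_base[of b "{c, a}"] by blast+
  moreover have "c \<noteq> 0"
    using c span_zero by metis
  ultimately have "independent {a, b, c}" "card {a, b, c} = 3"
    using a by (simp_all add: independent_insert)
  then show ?thesis
    by (metis dim_span dim_eq_card_independent)
qed

lemma null_3_vector_formI:
  assumes "T \<noteq> 0" "T = a \<and>\<^sub>3 b \<and>\<^sub>2 c" "S = span {a, b, c}"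
    and "\<And>u v. u \<in> S \<Longrightarrow> v \<in> S \<Longrightarrow> u \<bullet>\<^sub>3\<^sub>3 v = 0"
  shows "null_3_vector_form T S"
  unfolding null_3_vector_form_def null_3_space_def
  using assms dim_span_wedge3[of a b c] by (metis subspace_span)

lemma point_trivector_nonzero:
  assumes "(x0, x) \<noteq> 0"
  shows "point_trivector x0 x \<noteq> 0"
proof
  assume "point_trivector x0 x = 0"
  then have *: "point_trivector x0 x $ i $ j $ k = 0" for i j k by simp
  have "x0 = 0 \<and> x $ 1 = 0 \<and> x $ 2 = 0 \<and> x $ 3 = 0"
    \<comment> \<open>These four components are the squares of \<open>x0\<close>,
      \<open>x $ 1\<close>, \<open>x $ 2\<close> and \<open>x $ 3\<close>: the first comes from
      \<open>I3\<close>, the others from the contraction with \<open>J3\<close>.\<close>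
    using *[of "Inl 1" "Inl 2" "Inl 3"] *[of "Inl 1" "Inr 2" "Inr 3"]
      *[of "Inl 2" "Inr 3" "Inr 1"]  *[of "Inl 3" "Inr 1" "Inr 2"]
    by (simp add: point_trivector_expand wedge2_def wedge3_def sum_3)
  with assms show False
    by (simp add: prod_eq_iff vec_eq_iff forall_3)
qed

section \<open>The space of a point and its 3-vector form\<close>

lemma form33_outer_same: "outer X Y \<bullet>\<^sub>3\<^sub>3 outer X Z = 0"
  \<comment> \<open>The form of two lines XY and ZW is the determinant of X, Y, Z, W; here X occurs
    twice.\<close>
  by (simp add: form33_def sum_3 cross3_simps)

lemma linear_outer: "linear (outer X)"
  using bilinear_outer unfolding bilinear_def by blast

lemma point_space_eq_span_range: "point_space X = span (range (outer X))"
proof -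
  have "{outer X Y |Y. True} = range (outer X)" by auto
  then show ?thesis by (simp add: point_space_def)
qed

lemma point_space_eq: "point_space X = range (outer X)"
proof -
  have "subspace (range (outer X))"
    by (rule linear_subspace_image[OF linear_outer subspace_UNIV])
  then show ?thesis
    by (simp add: point_space_eq_span_range span_eq_iff)
qed

text \<open>For Y = (y0, y), the product of (x0, x) with Y has e = x0 y - y0 x and m = x \<times> y,
  whence the two equations. This is the converse: a solution Y can be recovered from e and
  m.\<close>

lemma mem_point_spaceI:
  fixes v :: vec33
  defines "e \<equiv> \<chi> i. v $ Inl i" and "m \<equiv> \<chi> i. v $ Inr i"
  assumes "(x0, x) \<noteq> 0" and m: "x0 *\<^sub>R m = cross3 x e" and "x \<bullet> m = 0"
  shows "v \<in> point_space (x0, x)"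
proof -
  have "\<exists>Y. v = outer (x0, x) Y"
  proof (cases "x0 = 0")
    case False
    then have "m = cross3 x (e /\<^sub>R x0)"
      by (simp add: cross_mult_right flip: m)
    \<comment> \<open>Y matters only modulo X, so for nonzero \<open>x0\<close> its first coordinate
      can be taken to be 0.\<close>
    then have "v = outer (x0, x) (0, e /\<^sub>R x0)"
      using False by (simp add: vec33_eq_iff e_def m_def vec_eq_iff)
    then show ?thesis ..
  next
    case True
    then have x: "x \<noteq> 0" using assms(3) by (simp add: prod_eq_iff)
    \<comment> \<open>With \<open>x0 = 0\<close>, the vector \<open>e\<close> is parallel to
      \<open>x\<close>; the factor \<open>c\<close> determines the first coordinate of Y, while
      \<open>y\<close> has to solve x \<times> y = m, which is possible because m is orthogonal to
      x.\<close>
    have "cross3 x (cross3 e x) = (x \<bullet> x) *\<^sub>R e - (x \<bullet> e) *\<^sub>R x"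
      by (simp add: Lagrange)
    moreover have "cross3 e x = 0"
      using m True cross_skew[of e x] by simp
    moreover define c where "c = (x \<bullet> e) / (x \<bullet> x)"
    ultimately have e: "e = c *\<^sub>R x"
      using x by (simp add: eq_vector_fraction_iff)
    define y where "y = cross3 m x /\<^sub>R (x \<bullet> x)"
    have "cross3 x (cross3 m x) = (x \<bullet> x) *\<^sub>R m"
      using \<open>x \<bullet> m = 0\<close> by (simp add: Lagrange)
    then have m: "m = cross3 x y"
      using x by (simp add: y_def cross_mult_right)
    have "v $ Inl i = e $ i" "v $ Inr i = m $ i" for i
      by (simp_all add: e_def m_def)
    then have "v = outer (x0, x) (- c, y)"
      unfolding vec33_eq_iff using True by (simp add: e m)
    then show ?thesis ..
  qed
  then show ?thesis by (auto simp: point_space_eq)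
qed

text \<open>X, p, q, r span the whole of the 4-space, and the X component of Y drops out because XX
  = 0.\<close>

lemma point_space_eq_span:
  assumes "\<And>Y. \<exists>s k l m. Y = s *\<^sub>R X + k *\<^sub>R p + l *\<^sub>R q + m *\<^sub>R r"
  shows "point_space X = span {outer X p, outer X q, outer X r}"
proof
  show "point_space X \<subseteq> span {outer X p, outer X q, outer X r}"
  proof
    fix v assume "v \<in> point_space X"
    then obtain Y where v: "v = outer X Y" by (auto simp: point_space_eq)
    obtain s k l m where "Y = s *\<^sub>R X + k *\<^sub>R p + l *\<^sub>R q + m *\<^sub>R r" using assms by blast
    then have "v = k *\<^sub>R outer X p + l *\<^sub>R outer X q + m *\<^sub>R outer X r"
      by (simp add: v linear_add[OF linear_outer] linear_scale[OF linear_outer] outer_self)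
    then show "v \<in> span {outer X p, outer X q, outer X r}"
      by (auto intro!: span_add span_scale intro: span_base)
  qed
  have "span (outer X ` {p, q, r}) \<subseteq> span (range (outer X))"
    by (intro span_mono image_mono subset_UNIV)
  then show "span {outer X p, outer X q, outer X r} \<subseteq> point_space X"
    unfolding point_space_eq_span_range image_insert image_empty .
qed


lemma null_form_point_if:
  assumes "X = (x0, x)" "X \<noteq> 0" "t \<noteq> 0"
    and "outer X p \<and>\<^sub>3 outer X q \<and>\<^sub>2 outer X r = t *\<^sub>R point_trivector x0 x"
    and "\<And>Y. \<exists>s k l m. Y = s *\<^sub>R X + k *\<^sub>R p + l *\<^sub>R q + m *\<^sub>R r"
  shows "null_3_vector_form (point_trivector x0 x) (point_space X)"
proof (rule null_3_vector_formI)
  show "point_trivector x0 x \<noteq> 0"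
    using point_trivector_nonzero assms by blast
  \<comment> \<open>Rescaling one factor absorbs \<open>t\<close>, so the 3-vector itself, and not
    just a multiple of it, is decomposable.\<close>
  have "outer X (p /\<^sub>R t) = outer X p /\<^sub>R t"
    by (rule linear_scale[OF linear_outer])
  then show "point_trivector x0 x = outer X (p /\<^sub>R t) \<and>\<^sub>3 outer X q \<and>\<^sub>2 outer X r"
    using assms by (simp add: wedge3_scaleR)
  show "point_space X = span {outer X (p /\<^sub>R t), outer X q, outer X r}"
  proof (rule point_space_eq_span)
    fix Y
    obtain s k l m where "Y = s *\<^sub>R X + k *\<^sub>R p + l *\<^sub>R q + m *\<^sub>R r"
      using assms(5) by blast
    then have "Y = s *\<^sub>R X + (k * t) *\<^sub>R (p /\<^sub>R t) + l *\<^sub>R q + m *\<^sub>R r"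
      using \<open>t \<noteq> 0\<close> by simp
    then show "\<exists>s k l m. Y = s *\<^sub>R X + k *\<^sub>R (p /\<^sub>R t) + l *\<^sub>R q + m *\<^sub>R r"
      by blast
  qed
qed (auto simp: point_space_eq form33_outer_same)

lemma vec4_eq_iff:
  "X = Y \<longleftrightarrow> fst X = fst Y \<and> snd X $ 1 = snd Y $ 1 \<and> snd X $ 2 = snd Y $ 2 \<and> snd X $ 3 = snd Y $ 3"
  for X Y :: vec4
  by (auto simp: prod_eq_iff vec_eq_iff forall_3)

lemma null_form_point:
  assumes "(x0, x) \<noteq> 0"
  shows "null_3_vector_form (point_trivector x0 x) (point_space (x0, x))"
proof -
  consider "x0 \<noteq> 0" | "x $ 1 \<noteq> 0" | "x $ 2 \<noteq> 0" | "x $ 3 \<noteq> 0"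
    using assms by (auto simp: vec4_eq_iff)
  then show ?thesis
  proof cases
    case 1
    show ?thesis
    proof (rule null_form_point_if[OF refl assms 1 wedge_outer_emb])
      fix Y :: vec4
      \<comment> \<open>This \<open>s\<close> matches the one coordinate that the three chosen basis
        vectors do not reach; the other cases proceed alike with a nonzero coordinate of
        \<open>x\<close>.\<close>
      define s where "s = fst Y / x0"
      have "Y = s *\<^sub>R (x0, x) + (snd Y $ 1 - s * x $ 1) *\<^sub>R emb (axis 1 1)
          + (snd Y $ 2 - s * x $ 2) *\<^sub>R emb (axis 2 1) + (snd Y $ 3 - s * x $ 3) *\<^sub>R emb (axis 3 1)"
        using 1 by (simp add: vec4_eq_iff emb_def axis_def s_def)
      then show "\<exists>s k l m. Y = s *\<^sub>R (x0, x) + k *\<^sub>R emb (axis 1 1) + l *\<^sub>R emb (axis 2 1) + m *\<^sub>R emb (axis 3 1)"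
        by blast
    qed
  next
    case 2
    show ?thesis
    proof (rule null_form_point_if[OF refl assms _ wedge_outer_e0(1)])
      show "- (x $ 1) \<noteq> 0" using 2 by simp
      fix Y :: vec4
      define s where "s = snd Y $ 1 / x $ 1"
      have "Y = s *\<^sub>R (x0, x) + (fst Y - s * x0) *\<^sub>R e0
          + (snd Y $ 2 - s * x $ 2) *\<^sub>R emb (axis 2 1) + (snd Y $ 3 - s * x $ 3) *\<^sub>R emb (axis 3 1)"
        using 2 by (simp add: vec4_eq_iff emb_def e0_def axis_def s_def)
      then show "\<exists>s k l m. Y = s *\<^sub>R (x0, x) + k *\<^sub>R e0 + l *\<^sub>R emb (axis 2 1) + m *\<^sub>R emb (axis 3 1)"
        by blast
    qed
  next
    case 3
    show ?thesis
    proof (rule null_form_point_if[OF refl assms _ wedge_outer_e0(2)])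
      show "- (x $ 2) \<noteq> 0" using 3 by simp
      fix Y :: vec4
      define s where "s = snd Y $ 2 / x $ 2"
      have "Y = s *\<^sub>R (x0, x) + (fst Y - s * x0) *\<^sub>R e0
          + (snd Y $ 3 - s * x $ 3) *\<^sub>R emb (axis 3 1) + (snd Y $ 1 - s * x $ 1) *\<^sub>R emb (axis 1 1)"
        using 3 by (simp add: vec4_eq_iff emb_def e0_def axis_def s_def)
      then show "\<exists>s k l m. Y = s *\<^sub>R (x0, x) + k *\<^sub>R e0 + l *\<^sub>R emb (axis 3 1) + m *\<^sub>R emb (axis 1 1)"
        by blast
    qed
  next
    case 4
    show ?thesis
    proof (rule null_form_point_if[OF refl assms _ wedge_outer_e0(3)])
      show "- (x $ 3) \<noteq> 0" using 4 by simp
      fix Y :: vec4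
      define s where "s = snd Y $ 3 / x $ 3"
      have "Y = s *\<^sub>R (x0, x) + (fst Y - s * x0) *\<^sub>R e0
          + (snd Y $ 1 - s * x $ 1) *\<^sub>R emb (axis 1 1) + (snd Y $ 2 - s * x $ 2) *\<^sub>R emb (axis 2 1)"
        using 4 by (simp add: vec4_eq_iff emb_def e0_def axis_def s_def)
      then show "\<exists>s k l m. Y = s *\<^sub>R (x0, x) + k *\<^sub>R e0 + l *\<^sub>R emb (axis 1 1) + m *\<^sub>R emb (axis 2 1)"
        by blast
    qed
  qed
qed

section \<open>The exchange of the two halves of the basis\<close>

definition swap_index :: "'a + 'a \<Rightarrow> 'a + 'a" where
  "swap_index = case_sum Inr Inl"

lemma swap_index [simp]: "swap_index (Inl i) = Inr i" "swap_index (Inr i) = Inl i"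
  "swap_index (swap_index s) = s"
  by (auto simp: swap_index_def split: sum.split)

text \<open>The exchange permutes the basis, so it acts on vectors, and on tensors slot by slot, by
  pure reindexing.\<close>

definition dual :: "vec33 \<Rightarrow> vec33" where
  "dual a = (\<chi> i. a $ swap_index i)"

definition dual3 :: "(3 + 3) trivector \<Rightarrow> (3 + 3) trivector" where
  "dual3 T = (\<chi> i j k. T $ swap_index i $ swap_index j $ swap_index k)"

lemma dual_nth [simp]: "dual a $ i = a $ swap_index i"
  by (simp add: dual_def)

lemma dual_dual [simp]: "dual (dual a) = a"
  by (simp add: vec_eq_iff)

lemma linear_dual: "linear dual"
  by (rule linearI) (simp_all add: vec_eq_iff)

lemma form33_dual: "dual a \<bullet>\<^sub>3\<^sub>3 dual b = a \<bullet>\<^sub>3\<^sub>3 b"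
  by (simp add: form33_def algebra_simps)

lemma dual3_wedge: "dual3 (a \<and>\<^sub>3 b \<and>\<^sub>2 c) = dual a \<and>\<^sub>3 dual b \<and>\<^sub>2 dual c"
  by (simp add: dual3_def wedge2_def wedge3_def vec_eq_iff)

lemma dual3_dual3 [simp]: "dual3 (dual3 T) = T"
  by (simp add: dual3_def vec_eq_iff)

lemma null_3_vector_form_dual:
  assumes "null_3_vector_form T S"
  shows "null_3_vector_form (dual3 T) (dual ` S)"
proof -
  obtain a b c where abc: "T = a \<and>\<^sub>3 b \<and>\<^sub>2 c" "span {a, b, c} = S" and "T \<noteq> 0"
    and null: "\<forall>u\<in>S. \<forall>v\<in>S. u \<bullet>\<^sub>3\<^sub>3 v = 0"
    using assms by (auto simp: null_3_vector_form_def null_3_space_def)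
  show ?thesis
  proof (rule null_3_vector_formI)
    have "dual3 0 = 0" by (simp add: dual3_def vec_eq_iff)
    then show "dual3 T \<noteq> 0"
      using \<open>T \<noteq> 0\<close> dual3_dual3 by metis
    show "dual3 T = dual a \<and>\<^sub>3 dual b \<and>\<^sub>2 dual c"
      by (simp add: abc dual3_wedge)
    show "dual ` S = span {dual a, dual b, dual c}"
      using linear_span_image[OF linear_dual, of "{a, b, c}"] by (simp add: abc)
  qed (use null in \<open>auto simp: form33_dual\<close>)
qed

lemma plane_trivector_eq_dual: "plane_trivector n d = dual3 (point_trivector (- d) n)"
  unfolding point_trivector_expand plane_trivector_expand
  by (simp add: dual3_def vec_eq_iff forall_sum forall_3 wedge2_def wedge3_def sum_3)

section \<open>The space of a plane\<close>

lemma exists_cross3: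
  fixes z :: "real^3"
  obtains p q where "cross3 p q = z" "p \<bullet> z = 0" "q \<bullet> z = 0"
proof (cases "z = 0")
  case True
  then show ?thesis using that[of 0 0] by simp
next
  case False
  then obtain p where p: "p \<noteq> 0" "p \<bullet> z = 0"
    using orthogonal_to_vector_exists[of z] by (auto simp: orthogonal_def inner_commute)
  \<comment> \<open>As \<open>p\<close> is orthogonal to \<open>z\<close>, p \<times> (z \<times> p)
    is |p|^2 z; the scaling removes the factor.\<close>
  define q where "q = cross3 z p /\<^sub>R (p \<bullet> p)"
  have "cross3 p (cross3 z p) = (p \<bullet> p) *\<^sub>R z"
    using p by (simp add: Lagrange inner_commute)
  then have "cross3 p q = z"
    using p by (simp add: q_def cross_mult_right)
  moreover have "q \<bullet> z = 0"
    by (simp add: q_def dot_cross_self)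
  ultimately show ?thesis using that p by blast
qed

text \<open>Points of \<open>plane\<close> are nonzero, but a zero factor gives the product 0, which
  lies in every span.\<close>

lemma outer_mem_plane_space:
  assumes "d * fst X = n \<bullet> snd X" "d * fst Y = n \<bullet> snd Y"
  shows "outer X Y \<in> plane_space (n, - d)"
proof (cases "X = 0 \<or> Y = 0")
  case True
  then have "outer X Y = 0" by (auto simp: vec33_eq_iff)
  then show ?thesis by (simp add: plane_space_def span_zero)
next
  case False
  then show ?thesis
    unfolding plane_space_def using assms
    by (intro span_base CollectI exI[of _ X] exI[of _ Y]) (simp add: plane_def)
qed

lemma plane_space_eq_dual:
  assumes "(n, d) \<noteq> 0"
  shows "plane_space (n, - d) = dual ` point_space (- d, n)"
proof
  have "outer X Y \<in> dual ` point_space (- d, n)" if "X \<in> plane (n, - d)" "Y \<in> plane (n, - d)" for X Y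
  proof -
    have *: "d * fst X = n \<bullet> snd X" "d * fst Y = n \<bullet> snd Y"
      using that by (auto simp: plane_def)
    have "dual (outer X Y) \<in> point_space (- d, n)"
    proof (rule mem_point_spaceI)
      show "(- d, n) \<noteq> 0" using assms by (auto simp: prod_eq_iff)
      \<comment> \<open>After the exchange, e is the cross product of the vector parts. Expanding
        the double product and inserting the plane equations gives the first condition of
        \<open>mem_point_spaceI\<close>.\<close>
      have "cross3 n (cross3 (snd X) (snd Y)) = (n \<bullet> snd Y) *\<^sub>R snd X - (n \<bullet> snd X) *\<^sub>R snd Y"
        by (simp add: Lagrange)
      then show "- d *\<^sub>R (\<chi> i. dual (outer X Y) $ Inr i) = cross3 n (\<chi> i. dual (outer X Y) $ Inl i)"
        by (simp add: vec_eq_iff algebra_simps flip: *)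
      have "n \<bullet> (\<chi> i. dual (outer X Y) $ Inr i) = fst X * (n \<bullet> snd Y) - fst Y * (n \<bullet> snd X)"
        by (simp add: inner_vec_def sum_subtractf sum_distrib_left algebra_simps)
      then show "n \<bullet> (\<chi> i. dual (outer X Y) $ Inr i) = 0"
        by (simp flip: *)
    qed
    then show ?thesis by (metis dual_dual image_eqI)
  qed
  then show "plane_space (n, - d) \<subseteq> dual ` point_space (- d, n)"
    unfolding plane_space_def
    by (intro span_minimal) (auto simp: point_space_def intro!: linear_subspace_image[OF linear_dual])
next
  show "dual ` point_space (- d, n) \<subseteq> plane_space (n, - d)"
  proof
    fix v assume "v \<in> dual ` point_space (- d, n)"
    then obtain z0 z where v: "v = dual (outer (- d, n) (z0, z))"
      by (auto simp: point_space_eq)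
    show "v \<in> plane_space (n, - d)"
    proof (cases "n = 0")
      case True
      obtain p q where "cross3 p q = - d *\<^sub>R z" using exists_cross3 by metis
      then have "v = outer (0, p) (0, q)"
        using True by (simp add: v vec33_eq_iff)
      then show ?thesis
        using True by (simp add: outer_mem_plane_space)
    next
      case False
      define y where "y = - (d / (n \<bullet> n)) *\<^sub>R n"
      have y: "n \<bullet> y = - d" using False by (simp add: y_def)
      obtain p q where pq: "cross3 p q = n" "p \<bullet> n = 0" "q \<bullet> n = 0" using exists_cross3 by metis
      have "cross3 (cross3 n z) y = (n \<bullet> y) *\<^sub>R z - (z \<bullet> y) *\<^sub>R n"
        by (simp add: cross3_simps vec_eq_iff forall_3)
      then have cross: "cross3 (cross3 n z) y = - d *\<^sub>R z - (z \<bullet> y) *\<^sub>R n"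
        by (simp only: y)
      have "v = outer (0, cross3 n z) (- 1, y) - (z0 - z \<bullet> y) *\<^sub>R outer (0, p) (0, q)"
        unfolding v vec33_eq_iff by (simp add: cross pq(1)) (simp add: algebra_simps)
      moreover have "outer (0, cross3 n z) (- 1, y) \<in> plane_space (n, - d)"
        using y by (intro outer_mem_plane_space) (simp_all add: dot_cross_self)
      moreover have "outer (0, p) (0, q) \<in> plane_space (n, - d)"
        using pq by (intro outer_mem_plane_space) (simp_all add: inner_commute)
      ultimately show ?thesis
        by (simp add: plane_space_def span_diff span_scale)
    qed
  qed
qed

theorem proposition6:
  "(\<forall>(x0::real) (x::real^3). (x0, x) \<noteq> 0 \<longrightarrow>
      null_3_vector_form
        (outer e0 (emb x) \<and>\<^sub>3 contract (outer e0 (emb x)) J3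
           - x0 *\<^sub>R (outer e0 (emb x) \<and>\<^sub>3 K2) + x0\<^sup>2 *\<^sub>R I3)
        (point_space (x0 *\<^sub>R e0 + emb x)))
   \<and> (\<forall>(n::real^3) (d::real). (n, d) \<noteq> 0 \<longrightarrow>
      null_3_vector_form
        (perp n \<and>\<^sub>3 contract (perp n) I3 - d *\<^sub>R (perp n \<and>\<^sub>3 K2) + d\<^sup>2 *\<^sub>R J3)
        (plane_space (n, - d)))"
proof -
  have "x0 *\<^sub>R e0 + emb x = (x0, x)" for x0 x
    by (simp add: e0_def emb_def)
  moreover have "null_3_vector_form (plane_trivector n d) (plane_space (n, - d))" if "(n, d) \<noteq> 0" for n d
  proof -
    have "(- d, n) \<noteq> 0" using that by (auto simp: prod_eq_iff)
    then show ?thesis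
      using null_3_vector_form_dual[OF null_form_point] that
      by (simp add: plane_trivector_eq_dual plane_space_eq_dual)
  qed
  ultimately show ?thesis
    using null_form_point by (simp flip: point_trivector_def plane_trivector_def)
qed

end
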